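(* For every integer $n\ge 2$, the whirl $W^n$ satisfies $T_{W^n}(2,0)\ge T_{W^n}(1,1)$, and hence $$\max\{T_{W^n}(2,0),\,T_{W^n}(0,2)\}\ \ge\ T_{W^n}(1,1).$$
   Context: The wheel graph $W_n$ has $n+1$ vertices $0,1,\dots,n$ and $2n$ edges: the vertices $1,\dots,n$ form an $n$-cycle, and the vertex $0$ is adjacent to every vertex of this cycle (for $n=2$ the $2$-cycle is a pair of parallel edges). The whirl $W^n$ is the matroid with ground set $E(W_n)$ whose bases are the edge set of the $n$-cycle on $\{1,\dots,n\}$ together with the edge sets of all spanning trees of $W_n$. For a matroid $M=(E,r)$, $T_M(x,y)=\sum_{A\subseteq E}(x-1)^{r(E)-r(A)}(y-1)^{|A|-r(A)}$ is the Tutte polynomial. *)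

theory Defs
  imports Complex_Main
begin

text \<open>
  Undirected multigraphs; an edge \<open>e\<close> joins \<open>u\<close> and \<open>v\<close> (a loop if \<open>u = v\<close>) iff
  \<open>ends G e = {u, v}\<close>.
\<close>

record ('v, 'e) multigraph =
  verts :: "'v set"
  edges :: "'e set"
  ends :: "'e \<Rightarrow> 'v set"

definition adj_rel :: "('v, 'e) multigraph \<Rightarrow> 'e set \<Rightarrow> ('v \<times> 'v) set" where
  "adj_rel G A = {(u, v). \<exists>e\<in>A. ends G e = {u, v}}"

definition connects :: "('v, 'e) multigraph \<Rightarrow> 'e set \<Rightarrow> bool" where
  "connects G A \<longleftrightarrow>
     verts G \<noteq> {} \<and> (\<forall>u\<in>verts G. \<forall>v\<in>verts G. (u, v) \<in> (adj_rel G A)\<^sup>*)"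

text \<open>
  A cycle runs through the distinct vertices \<open>vs\<close> along the distinct edges \<open>es\<close>, and back to the
  start. Length 1 is a loop, length 2 a pair of parallel edges.
\<close>

definition is_cycle :: "('v, 'e) multigraph \<Rightarrow> 'v list \<Rightarrow> 'e list \<Rightarrow> bool" where
  "is_cycle G vs es \<longleftrightarrow>
     es \<noteq> [] \<and> length vs = length es \<and> distinct vs \<and> distinct es \<and>
     set vs \<subseteq> verts G \<and> set es \<subseteq> edges G \<and>
     (\<forall>i<length es. ends G (es ! i) = {vs ! i, vs ! (Suc i mod length es)})"

definition acyclic_edges :: "('v, 'e) multigraph \<Rightarrow> 'e set \<Rightarrow> bool" where
  "acyclic_edges G A \<longleftrightarrow> \<not> (\<exists>vs es. is_cycle G vs es \<and> set es \<subseteq> A)"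

text \<open>A spanning tree is represented by its edge set; its vertex set is all of \<open>verts G\<close>.\<close>

definition spanning_tree :: "('v, 'e) multigraph \<Rightarrow> 'e set \<Rightarrow> bool" where
  "spanning_tree G A \<longleftrightarrow> A \<subseteq> edges G \<and> connects G A \<and> acyclic_edges G A"


text \<open>
  A matroid is given by its ground set and its set of bases. The record does not impose the basis
  axioms. The rank of \<open>A\<close> is the largest size of an intersection of \<open>A\<close> with a basis, that
  is, of an independent subset of \<open>A\<close>.
\<close>

record 'e matroid =
  ground :: "'e set"
  bases :: "'e set set"

definition rank :: "'e matroid \<Rightarrow> 'e set \<Rightarrow> nat" where
  "rank M A = Max ((\<lambda>B. card (A \<inter> B)) ` bases M)"

text \<open>
  The Tutte polynomial as a function of its two arguments. The truncated subtractions in the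
  exponents are exact since \<open>rank M A \<le> rank M (ground M)\<close> and \<open>rank M A \<le> card A\<close> for
  \<open>A \<subseteq> ground M\<close>.
\<close>

definition tutte :: "'e matroid \<Rightarrow> 'r::comm_ring_1 \<Rightarrow> 'r \<Rightarrow> 'r" where
  "tutte M x y =
     (\<Sum>A\<in>Pow (ground M).
        (x - 1) ^ (rank M (ground M) - rank M A) * (y - 1) ^ (card A - rank M A))"


text \<open>
  \<open>Rim i\<close> joins \<open>i\<close> to its cyclic successor in \<open>{1..n}\<close>, so that \<open>Rim 1\<close> and \<open>Rim 2\<close> are
  parallel for \<open>n = 2\<close>; \<open>Spoke i\<close> joins \<open>0\<close> to \<open>i\<close>.
\<close>

datatype wheel_edge = Rim nat | Spoke nat

fun wheel_ends :: "nat \<Rightarrow> wheel_edge \<Rightarrow> nat set" where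
  "wheel_ends n (Rim i) = {i, Suc (i mod n)}"
| "wheel_ends n (Spoke i) = {0, i}"

definition wheel :: "nat \<Rightarrow> (nat, wheel_edge) multigraph" where
  "wheel n =
     \<lparr>verts = {0..n}, edges = Rim ` {1..n} \<union> Spoke ` {1..n}, ends = wheel_ends n\<rparr>"

definition whirl :: "nat \<Rightarrow> wheel_edge matroid" where
  "whirl n =
     \<lparr>ground = edges (wheel n),
      bases = insert (Rim ` {1..n}) {A. spanning_tree (wheel n) A}\<rparr>"

end

theory Submission
  imports Defs "HOL-Library.FuncSet"
begin

text \<open>
  The bases of \<open>W\<^sup>n\<close> are the transversals of the \<open>n\<close> triples consisting of a spoke and the two rim
  edges at its rim end. Of the \<open>3\<^sup>n\<close> choices of one edge from each triple, two give the full rim, so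
  \<open>T(1,1) \<le> 3\<^sup>n - 1\<close>.

  On the other side \<open>T(2,0)\<close> is the sum of \<open>(-1)\<close> to the nullity. Fix the nonempty set \<open>C\<close> of absent
  rim edges. It cuts the rim into \<open>|C|\<close> arcs, and the sum over the sets of spokes factors over the
  arcs, each of which contributes \<open>2\<close>; if no rim edge is absent, the sum over the spokes vanishes.
  Hence \<open>T(2,0)\<close> is the sum of \<open>2\<^sup>|\<^sup>C\<^sup>|\<close> over the nonempty \<open>C\<close>, which is \<open>3\<^sup>n - 1\<close>.
\<close>

section \<open>Connectivity, cycles and spanning trees in multigraphs\<close>

lemma adj_rel_sym: "sym (adj_rel G A)"
  unfolding adj_rel_def sym_def by (auto simp: insert_commute)

lemma rtrancl_adj_rel_commute: "(u, v) \<in> (adj_rel G A)\<^sup>* \<Longrightarrow> (v, u) \<in> (adj_rel G A)\<^sup>*"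
  using adj_rel_sym by (metis sym_rtrancl symD)

lemma connects_root:
  assumes "r \<in> verts G" and "\<And>v. v \<in> verts G \<Longrightarrow> (v, r) \<in> (adj_rel G A)\<^sup>*"
  shows "connects G A"
  unfolding connects_def
proof (intro conjI ballI)
  fix u v assume "u \<in> verts G" "v \<in> verts G"
  then have "(u, r) \<in> (adj_rel G A)\<^sup>*" "(r, v) \<in> (adj_rel G A)\<^sup>*"
    using assms(2) rtrancl_adj_rel_commute by metis+
  then show "(u, v) \<in> (adj_rel G A)\<^sup>*" by (rule rtrancl_trans)
qed (use assms(1) in auto)

text \<open>Each vertex other than \<open>r\<close> takes the first edge of a shortest walk to
  \<open>r\<close>. The distance drops along this edge, so following the chosen edges leads to
  \<open>r\<close> and no two vertices share an edge.\<close>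

lemma connects_parent_edges:
  assumes conn: "connects G A" and r: "r \<in> verts G"
    and wf: "\<And>e. e \<in> A \<Longrightarrow> ends G e \<subseteq> verts G"
  obtains f where "inj_on f (verts G - {r})"
    and "\<And>v. v \<in> verts G - {r} \<Longrightarrow> f v \<in> A \<and> v \<in> ends G (f v)"
    and "connects G (f ` (verts G - {r}))"
proof -
  define d where "d v = (LEAST k. (v, r) \<in> adj_rel G A ^^ k)" for v
  have ex: "\<exists>e\<in>A. \<exists>w\<in>verts G. ends G e = {v, w} \<and> d w < d v" if v: "v \<in> verts G - {r}" for v
  proof -
    have "(v, r) \<in> (adj_rel G A)\<^sup>*" using conn v r unfolding connects_def by auto
    then obtain k where "(v, r) \<in> adj_rel G A ^^ k" using rtrancl_power by metis
    then have dv: "(v, r) \<in> adj_rel G A ^^ d v" unfolding d_def by (rule LeastI)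
    have "d v \<noteq> 0" using dv v by (metis DiffD2 insertI1 relpow_0_E)
    then obtain m where m: "d v = Suc m" using not0_implies_Suc by blast
    then obtain w where w: "(v, w) \<in> adj_rel G A" "(w, r) \<in> adj_rel G A ^^ m"
      using dv by (metis relpow_Suc_E2)
    have "d w \<le> m" unfolding d_def by (rule Least_le) (rule w(2))
    moreover obtain e where "e \<in> A" "ends G e = {v, w}" using w(1) unfolding adj_rel_def by auto
    ultimately show ?thesis using m wf by fastforce
  qed
  then obtain f p where fp: "\<And>v. v \<in> verts G - {r} \<Longrightarrow>
      f v \<in> A \<and> p v \<in> verts G \<and> ends G (f v) = {v, p v} \<and> d (p v) < d v"
    by metis
  show thesis
  proof (rule that)
    show "inj_on f (verts G - {r})"
    proof (rule inj_onI)
      fix v w assume v: "v \<in> verts G - {r}" and w: "w \<in> verts G - {r}" and eq: "f v = f w"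
      \<comment> \<open>If \<open>v\<close> and \<open>w\<close> differed, each would be the parent
        of the other, and the distance would have to drop both ways.\<close>
      have "{v, p v} = {w, p w}" "d (p v) < d v" "d (p w) < d w" using fp[OF v] fp[OF w] eq by auto
      then show "v = w" by (metis doubleton_eq_iff less_asym)
    qed
    show "f v \<in> A \<and> v \<in> ends G (f v)" if "v \<in> verts G - {r}" for v using fp[OF that] by auto
    have "(v, r) \<in> (adj_rel G (f ` (verts G - {r})))\<^sup>*" if "v \<in> verts G" for v
      using that
    proof (induction "d v" arbitrary: v rule: less_induct)
      case less
      show ?case
      proof (cases "v = r")
        case False
        then have v: "v \<in> verts G - {r}" using less.prems by auto
        then have "(v, p v) \<in> adj_rel G (f ` (verts G - {r}))"
          unfolding adj_rel_def using fp[OF v] by auto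
        moreover have "(p v, r) \<in> (adj_rel G (f ` (verts G - {r})))\<^sup>*"
          using less.hyps fp[OF v] by auto
        ultimately show ?thesis by (rule converse_rtrancl_into_rtrancl)
      qed simp
    qed
    then show "connects G (f ` (verts G - {r}))" using connects_root r by metis
  qed
qed

text \<open>A walk is built from its far end. When the new first vertex already lies on the path,
  the path is cut to start there instead of being extended.\<close>

lemma simple_path_exists:
  assumes "(u, v) \<in> (adj_rel G A)\<^sup>*" and "v \<in> verts G"
    and wf: "\<And>e. e \<in> A \<Longrightarrow> ends G e \<subseteq> verts G"
  shows "\<exists>vs es. length vs = Suc (length es) \<and> distinct vs \<and> distinct es \<and> set vs \<subseteq> verts G \<and>
    set es \<subseteq> A \<and> vs ! 0 = u \<and> vs ! length es = v \<and>
    (\<forall>i<length es. ends G (es ! i) = {vs ! i, vs ! Suc i})"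
  using assms(1)
proof (induction rule: converse_rtrancl_induct)
  case base
  show ?case by (rule exI[of _ "[v]"], rule exI[of _ "[]"]) (use assms(2) in auto)
next
  case (step u w)
  then obtain vs es where p: "length vs = Suc (length es)" "distinct vs" "distinct es"
    "set vs \<subseteq> verts G" "set es \<subseteq> A" "vs ! 0 = w" "vs ! length es = v"
    "\<forall>i<length es. ends G (es ! i) = {vs ! i, vs ! Suc i}" by blast
  obtain e where e: "e \<in> A" "ends G e = {u, w}" using step(1) unfolding adj_rel_def by auto
  show ?case
  proof (cases "u \<in> set vs")
    case True
    then obtain k where k: "k < length vs" "vs ! k = u" by (metis in_set_conv_nth)
    have "set (drop k vs) \<subseteq> verts G" "set (drop k es) \<subseteq> A"
      using p(4,5) set_drop_subset by (metis order_trans)+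
    moreover have "length (drop k vs) = Suc (length (drop k es))" "drop k vs ! 0 = u"
      "drop k vs ! length (drop k es) = v" using k p(1,7) by auto
    moreover have "\<forall>i<length (drop k es). ends G (drop k es ! i) = {drop k vs ! i, drop k vs ! Suc i}"
      using k p(1,8) by auto
    ultimately show ?thesis using p(2,3) distinct_drop by metis
  next
    case False
    have "e \<notin> set es"
    proof
      assume "e \<in> set es"
      then obtain i where "i < length es" "es ! i = e" by (metis in_set_conv_nth)
      then have "{u, w} = {vs ! i, vs ! Suc i}" "{vs ! i, vs ! Suc i} \<subseteq> set vs" using p e by auto
      then show False using False by blast
    qed
    moreover have "u \<in> verts G" using wf[OF e(1)] e(2) by auto
    moreover have "\<forall>i<length (e # es). ends G ((e # es) ! i) = {(u # vs) ! i, (u # vs) ! Suc i}"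
      using p(6,8) e(2) by (auto simp: nth_Cons split: nat.split)
    ultimately show ?thesis
      using p(1-5,7) e(1) False by (intro exI[of _ "u # vs"] exI[of _ "e # es"]) simp
  qed
qed

text \<open>An edge of \<open>A\<close> outside \<open>B\<close> would close a cycle with a simple
  path in \<open>B\<close> between its ends; a loop closes the empty path.\<close>

lemma acyclic_connected_subset_eq:
  assumes acyc: "acyclic_edges G A" and conn: "connects G B" and BA: "B \<subseteq> A"
    and sub: "A \<subseteq> edges G"
    and wf: "\<And>e. e \<in> A \<Longrightarrow> \<exists>u\<in>verts G. \<exists>v\<in>verts G. ends G e = {u, v}"
  shows "B = A"
proof (rule ccontr)
  assume "B \<noteq> A"
  then obtain e where e: "e \<in> A" "e \<notin> B" using BA by auto
  obtain u v where uv: "u \<in> verts G" "v \<in> verts G" "ends G e = {u, v}" using wf[OF e(1)] by auto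
  have wfB: "\<And>e. e \<in> B \<Longrightarrow> ends G e \<subseteq> verts G" using wf BA by fastforce
  have "(u, v) \<in> (adj_rel G B)\<^sup>*" using conn uv unfolding connects_def by auto
  from simple_path_exists[OF this uv(2) wfB]
  obtain vs es where p: "length vs = Suc (length es)" "distinct vs" "distinct es"
    "set vs \<subseteq> verts G" "set es \<subseteq> B" "vs ! 0 = u" "vs ! length es = v"
    "\<forall>i<length es. ends G (es ! i) = {vs ! i, vs ! Suc i}" by blast
  have "is_cycle G vs (es @ [e])"
    unfolding is_cycle_def
  proof (intro conjI allI impI)
    fix i assume "i < length (es @ [e])"
    then consider "i < length es" | "i = length es" by fastforce
    then show "ends G ((es @ [e]) ! i) = {vs ! i, vs ! (Suc i mod length (es @ [e]))}"
      by cases (use p uv(3) in \<open>simp_all add: nth_append insert_commute\<close>)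
  qed (use p e BA sub in auto)
  moreover have "set (es @ [e]) \<subseteq> A" using p e BA by auto
  ultimately show False using acyc unfolding acyclic_edges_def by blast
qed

text \<open>The rest of the cycle still joins the ends of the deleted edge.\<close>

lemma connects_remove_cycle_edge:
  assumes conn: "connects G A" and cyc: "is_cycle G vs es" and sub: "set es \<subseteq> A"
  shows "connects G (A - {es ! 0})"
proof -
  let ?R = "adj_rel G (A - {es ! 0})"
  define m where "m = length es"
  have m: "m > 0" "length vs = m" "distinct es"
    "\<And>i. i < m \<Longrightarrow> ends G (es ! i) = {vs ! i, vs ! (Suc i mod m)}"
    using cyc unfolding is_cycle_def m_def by auto
  have stp: "(vs ! i, vs ! (Suc i mod m)) \<in> ?R" if "0 < i" "i < m" for i
  proof -
    have "es ! i \<noteq> es ! 0" using that m by (simp add: nth_eq_iff_index_eq m_def)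
    moreover have "es ! i \<in> A" using that sub by (auto simp: m_def)
    ultimately show ?thesis unfolding adj_rel_def using m(4)[OF that(2)] by auto
  qed
  have path: "(vs ! 1, vs ! i) \<in> ?R\<^sup>*" if "1 \<le> i" "i < m" for i
    using that
  proof (induction i rule: nat_induct_at_least)
    case (Suc i)
    then have "(vs ! i, vs ! Suc i) \<in> ?R" using stp[of i] by simp
    then show ?case using Suc by (meson Suc_lessD rtrancl.rtrancl_into_rtrancl)
  qed simp
  \<comment> \<open>For \<open>m = 1\<close> the deleted edge is a loop and its ends coincide;
    otherwise the detour runs from \<open>vs ! 1\<close> up to the last vertex and from there to
    \<open>vs ! 0\<close>.\<close>
  have e0: "(vs ! 0, vs ! (Suc 0 mod m)) \<in> ?R\<^sup>*"
  proof (cases "m = 1")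
    case False
    then have "(vs ! 1, vs ! (m - 1)) \<in> ?R\<^sup>*" "(vs ! (m - 1), vs ! 0) \<in> ?R"
      using path[of "m - 1"] stp[of "m - 1"] m(1) by auto
    then have "(vs ! 1, vs ! 0) \<in> ?R\<^sup>*" by (rule rtrancl_into_rtrancl)
    then show ?thesis using False m(1) rtrancl_adj_rel_commute by fastforce
  qed simp
  have "adj_rel G A \<subseteq> ?R\<^sup>*"
  proof clarify
    fix a b assume "(a, b) \<in> adj_rel G A"
    then obtain e where e: "e \<in> A" "ends G e = {a, b}" unfolding adj_rel_def by auto
    show "(a, b) \<in> ?R\<^sup>*"
    proof (cases "e = es ! 0")
      case True
      then have "{a, b} = {vs ! 0, vs ! (Suc 0 mod m)}" using e m by auto
      then show ?thesis using e0 rtrancl_adj_rel_commute[OF e0] by (metis doubleton_eq_iff)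
    next
      case False
      then have "(a, b) \<in> ?R" using e unfolding adj_rel_def by auto
      then show ?thesis by blast
    qed
  qed
  then have "(adj_rel G A)\<^sup>* \<subseteq> ?R\<^sup>*" by (rule rtrancl_subset_rtrancl)
  then show ?thesis using conn unfolding connects_def by auto
qed

text \<open>Parent edges show that a connected graph on v vertices has at least v - 1 edges. A cycle
  would allow one edge to be deleted without losing connectivity, leaving too few.\<close>

lemma connected_few_edges_acyclic:
  assumes conn: "connects G A" and "finite A" and "card A < card (verts G)"
    and wf: "\<And>e. e \<in> A \<Longrightarrow> ends G e \<subseteq> verts G"
  shows "acyclic_edges G A"
  unfolding acyclic_edges_def
proof clarify
  fix vs es assume cyc: "is_cycle G vs es" and sub: "set es \<subseteq> A"
  obtain r where r: "r \<in> verts G" using conn unfolding connects_def by auto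
  have e0: "es ! 0 \<in> A" using cyc sub unfolding is_cycle_def by auto
  have conn': "connects G (A - {es ! 0})" using connects_remove_cycle_edge[OF conn cyc sub] .
  obtain f where f: "inj_on f (verts G - {r})"
    "\<And>v. v \<in> verts G - {r} \<Longrightarrow> f v \<in> A - {es ! 0} \<and> v \<in> ends G (f v)"
    by (rule connects_parent_edges[OF conn' r]) (use wf in auto)
  have "card (verts G - {r}) \<le> card (A - {es ! 0})"
    by (rule card_inj_on_le[OF f(1)]) (use f(2) assms(2) in auto)
  moreover have "card (A - {es ! 0}) < card A" using e0 assms(2) by (meson card_Diff1_less)
  moreover have "card (verts G - {r}) = card (verts G) - 1" using r by simp
  ultimately show False using assms(3) by linarith
qed

section \<open>Signed sums over subsets\<close>

lemma sum_Pow_binomial: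
  fixes a b :: "'a::comm_semiring_1"
  assumes "finite X"
  shows "(\<Sum>S\<in>Pow X. a ^ card S * b ^ (card X - card S)) = (a + b) ^ card X"
proof -
  have "(\<Sum>S\<in>Pow X. a ^ card S * b ^ (card X - card S)) = (\<Sum>S\<in>Pow X. (\<Prod>x\<in>S. a) * (\<Prod>x\<in>X - S. b))"
    by (rule sum.cong) (use assms in \<open>auto simp: card_Diff_subset finite_subset[OF _ assms]\<close>)
  also have "\<dots> = (\<Prod>x\<in>X. a + b)" by (rule prod_add[OF assms, symmetric])
  finally show ?thesis by simp
qed

text \<open>The sum factors over the fibres of \<open>g\<close>. On one fibre the empty set gives 1
  and a nonempty \<open>U\<close> gives (-1)^(|U| - 1); the latter add up to 1, so each fibre
  contributes 2. In the application the fibres are the arcs of the rim.\<close>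

lemma sum_Pow_signed_image_excess:
  fixes g :: "'a \<Rightarrow> 'b"
  assumes "finite C" and "finite X" and "g ` X = C"
  shows "(\<Sum>S\<in>Pow X. (-1 :: 'r::comm_ring_1) ^ (card S - card (g ` S))) = 2 ^ card C"
  using assms
proof (induction C arbitrary: X rule: finite_induct)
  case empty
  then show ?case by simp
next
  case (insert c C)
  let ?w = "\<lambda>S. (-1 :: 'r) ^ (card S - card (g ` S))"
  define F where "F = {x \<in> X. g x = c}"
  define X' where "X' = {x \<in> X. g x \<noteq> c}"
  have X: "X = X' \<union> F" "X' \<inter> F = {}" "finite X'" "finite F" "F \<noteq> {}" "g ` X' = C"
  proof -
    have "c \<in> g ` X" using insert.prems by simp
    then show "F \<noteq> {}" unfolding F_def by auto
    show "g ` X' = C" using insert.prems insert.hyps unfolding X'_def by auto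
  qed (use insert.prems in \<open>auto simp: F_def X'_def\<close>)
  have bij: "bij_betw (\<lambda>(S, U). S \<union> U) (Pow X' \<times> Pow F) (Pow X)"
    by (rule bij_betwI[where g = "\<lambda>S. (S \<inter> X', S \<inter> F)"]) (use X in auto)
  have w: "?w (S \<union> U) = ?w S * ?w U" if "S \<subseteq> X'" "U \<subseteq> F" for S U
  proof -
    have fin: "finite S" "finite U" using that X(3,4) finite_subset by metis+
    have "S \<inter> U = {}" "g ` S \<inter> g ` U = {}" using that unfolding F_def X'_def by auto
    then have "card (S \<union> U) = card S + card U" "card (g ` (S \<union> U)) = card (g ` S) + card (g ` U)"
      using fin by (auto simp: card_Un_disjoint image_Un)
    moreover have "card (g ` S) \<le> card S" "card (g ` U) \<le> card U" using fin by (auto intro: card_image_le)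
    ultimately have "card (S \<union> U) - card (g ` (S \<union> U)) = (card S - card (g ` S)) + (card U - card (g ` U))"
      by linarith
    then show ?thesis by (simp add: power_add)
  qed
  have wF: "?w U = - ((-1) ^ card U)" if U: "U \<in> Pow F - {{}}" for U
  proof -
    have "g ` U = {c}" using U unfolding F_def by auto
    moreover have "card U \<noteq> 0" using U finite_subset[OF _ X(4), of U] by auto
    ultimately show ?thesis by (cases "card U") auto
  qed
  \<comment> \<open>The alternating sum vanishes because the fibre \<open>F\<close> is
    nonempty.\<close>
  have "(\<Sum>U\<in>Pow F. (-1 :: 'r) ^ card U) = 0"
    using sum_Pow_binomial[of F "-1 :: 'r" 1] X by (simp add: power_0_left)
  then have "(\<Sum>U\<in>Pow F - {{}}. (-1 :: 'r) ^ card U) = - 1"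
    using X by (simp add: sum_diff1)
  then have "(\<Sum>U\<in>Pow F - {{}}. ?w U) = 1"
    using wF by (simp add: sum_negf)
  then have two: "(\<Sum>U\<in>Pow F. ?w U) = 2"
    using X by (simp add: sum.remove[of _ "{}"])
  have "(\<Sum>S\<in>Pow X. ?w S) = (\<Sum>(S, U)\<in>Pow X' \<times> Pow F. ?w (S \<union> U))"
    using sum.reindex_bij_betw[OF bij, of ?w] by (simp add: case_prod_unfold)
  also have "\<dots> = (\<Sum>(S, U)\<in>Pow X' \<times> Pow F. ?w S * ?w U)"
    by (rule sum.cong) (use w in auto)
  also have "\<dots> = (\<Sum>S\<in>Pow X'. ?w S) * (\<Sum>U\<in>Pow F. ?w U)"
    by (simp add: sum_product sum.cartesian_product)
  also have "\<dots> = 2 ^ card (insert c C)"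
    using insert.IH[OF X(3,6)] two insert.hyps by (simp add: mult.commute)
  finally show ?case .
qed

section \<open>Bases and rank of the whirl\<close>

lemma wheel_simps [simp]:
  "verts (wheel n) = {0..n}" "edges (wheel n) = Rim ` {1..n} \<union> Spoke ` {1..n}"
  "ends (wheel n) = wheel_ends n"
  by (auto simp: wheel_def)

lemma ground_whirl: "ground (whirl n) = Rim ` {1..n} \<union> Spoke ` {1..n}"
  by (simp add: whirl_def)

lemma bases_whirl: "bases (whirl n) = insert (Rim ` {1..n}) {A. spanning_tree (wheel n) A}"
  by (simp add: whirl_def)

lemma wheel_ends_vertices:
  assumes "e \<in> edges (wheel n)"
  shows "\<exists>u\<in>{0..n}. \<exists>v\<in>{0..n}. wheel_ends n e = {u, v}"
proof (cases e)
  case (Rim i)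
  then have "Suc (i mod n) \<in> {0..n}" using assms by (auto intro!: Suc_leI mod_less_divisor)
  then show ?thesis using Rim assms by fastforce
qed (use assms in fastforce)

lemma wheel_ends_subset: "e \<in> edges (wheel n) \<Longrightarrow> wheel_ends n e \<subseteq> {0..n}"
  by (drule wheel_ends_vertices) auto

lemma card_rim_Un_spoke:
  assumes "finite R" "finite S"
  shows "card (Rim ` R \<union> Spoke ` S) = card R + card S"
proof -
  have "card (Rim ` R \<union> Spoke ` S) = card (Rim ` R) + card (Spoke ` S)"
    by (rule card_Un_disjoint) (use assms in auto)
  then show ?thesis by (simp add: card_image inj_on_def)
qed

text \<open>
  The whirl is transversal: a basis is a system of distinct representatives for the edge sets at
  the rim vertices. For a spanning tree, represent each vertex by the first edge on its path to the hub.
\<close>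

lemma whirl_basis_transversal:
  assumes "B \<in> bases (whirl n)"
  obtains f where "inj_on f {1..n}" "f ` {1..n} = B"
    "\<And>i. i \<in> {1..n} \<Longrightarrow> f i \<in> ground (whirl n) \<and> i \<in> wheel_ends n (f i)"
proof (cases "B = Rim ` {1..n}")
  case True
  show thesis by (rule that[of Rim]) (use True in \<open>auto simp: ground_whirl inj_on_def\<close>)
next
  case False
  then have tree: "B \<subseteq> edges (wheel n)" "connects (wheel n) B" "acyclic_edges (wheel n) B"
    using assms by (auto simp: bases_whirl spanning_tree_def simp del: wheel_simps)
  have V: "verts (wheel n) - {0} = {1..n}" by auto
  obtain f where f: "inj_on f {1..n}"
    "\<And>v. v \<in> {1..n} \<Longrightarrow> f v \<in> B \<and> v \<in> wheel_ends n (f v)"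
    "connects (wheel n) (f ` {1..n})"
  proof (rule connects_parent_edges[OF tree(2), of 0])
    show "ends (wheel n) e \<subseteq> verts (wheel n)" if "e \<in> B" for e
      using wheel_ends_subset[of e n] that tree(1) by auto
  next
    show "0 \<in> verts (wheel n)" by simp
  qed (unfold V, auto)
  \<comment> \<open>The parent edges alone connect the wheel, and a tree has no proper connecting
    subset, so they exhaust \<open>B\<close>.\<close>
  have "f ` {1..n} = B"
  proof (rule acyclic_connected_subset_eq[OF tree(3) f(3) _ tree(1)])
    show "\<exists>u\<in>verts (wheel n). \<exists>v\<in>verts (wheel n). ends (wheel n) e = {u, v}" if "e \<in> B" for e
      using wheel_ends_vertices[of e n] that tree(1) unfolding wheel_simps by blast
  qed (use f(2) in blast)
  then show thesis
    using that[of f] f tree(1) by (auto simp: ground_whirl subset_eq)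
qed

lemma whirl_basis_card: "B \<in> bases (whirl n) \<Longrightarrow> card B = n"
  by (elim whirl_basis_transversal) (metis card_atLeastAtMost card_image diff_Suc_1)

lemma whirl_basis_subset: "B \<in> bases (whirl n) \<Longrightarrow> B \<subseteq> ground (whirl n)"
  by (elim whirl_basis_transversal) blast

lemma finite_ground_whirl: "finite (ground (whirl n))"
  by (simp add: ground_whirl)

lemma finite_bases_whirl: "finite (bases (whirl n))"
  by (rule finite_subset[of _ "Pow (ground (whirl n))"])
    (use whirl_basis_subset finite_ground_whirl in auto)

lemma rank_whirl_ge: "B \<in> bases (whirl n) \<Longrightarrow> card (A \<inter> B) \<le> rank (whirl n) A"
  unfolding rank_def by (rule Max_ge) (use finite_bases_whirl in auto)

lemma rank_whirl_attained:
  obtains B where "B \<in> bases (whirl n)" "rank (whirl n) A = card (A \<inter> B)"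
proof -
  have "rank (whirl n) A \<in> (\<lambda>B. card (A \<inter> B)) ` bases (whirl n)"
    unfolding rank_def by (rule Max_in) (use finite_bases_whirl in \<open>auto simp: bases_whirl\<close>)
  then show thesis using that by auto
qed

lemma rank_whirl_le: "rank (whirl n) A \<le> n"
proof -
  obtain B where B: "B \<in> bases (whirl n)" "rank (whirl n) A = card (A \<inter> B)"
    by (rule rank_whirl_attained)
  have "card (A \<inter> B) \<le> card B"
    using whirl_basis_subset[OF B(1)] finite_ground_whirl by (meson card_mono finite_subset inf_le2)
  then show ?thesis using B whirl_basis_card by metis
qed

lemma rank_whirl_rim:
  assumes "Rim ` {1..n} \<subseteq> A"
  shows "rank (whirl n) A = n"
proof -
  have "card (A \<inter> Rim ` {1..n}) = n"
    using assms by (simp add: Int_absorb1 card_image inj_on_def)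
  moreover have "Rim ` {1..n} \<in> bases (whirl n)" by (simp add: bases_whirl)
  ultimately show ?thesis using rank_whirl_ge[of "Rim ` {1..n}" n A] rank_whirl_le[of n A] by auto
qed

lemma rank_ground_whirl: "rank (whirl n) (ground (whirl n)) = n"
  by (rule rank_whirl_rim) (simp add: ground_whirl)

section \<open>The value at (1,1) and the number of bases\<close>

text \<open>Only the sets with both exponents zero survive. Such a set has rank and size
  \<open>n\<close>, so it equals a basis that attains its rank.\<close>

lemma tutte_1_1_le_card_bases: "tutte (whirl n) (1::real) 1 \<le> card (bases (whirl n))"
proof -
  let ?G = "ground (whirl n)"
  have basis: "A \<in> bases (whirl n)" if A: "A \<subseteq> ?G" "n - rank (whirl n) A = 0" "card A - rank (whirl n) A = 0" for A
  proof -
    obtain B where B: "B \<in> bases (whirl n)" "rank (whirl n) A = card (A \<inter> B)"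
      by (rule rank_whirl_attained)
    have r: "card (A \<inter> B) = n" using A(2) B rank_whirl_le[of n A] by auto
    have fin: "finite A" "finite B" using A(1) B whirl_basis_subset finite_ground_whirl finite_subset by metis+
    have "A \<inter> B = B" by (rule card_subset_eq) (use fin r whirl_basis_card[OF B(1)] in auto)
    moreover have "A \<inter> B = A"
    proof (rule card_subset_eq)
      show "card (A \<inter> B) = card A" using A(3) B(2) card_mono[of A "A \<inter> B"] fin by auto
    qed (use fin in auto)
    ultimately show ?thesis using B by metis
  qed
  have "tutte (whirl n) (1::real) 1 \<le> (\<Sum>A\<in>Pow ?G. of_bool (A \<in> bases (whirl n)))"
    unfolding tutte_def rank_ground_whirl
    by (rule sum_mono) (use basis in \<open>auto simp: power_0_left\<close>)
  also have "\<dots> = card (Pow ?G \<inter> bases (whirl n))"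
    using finite_ground_whirl by (simp add: sum.If_cases of_bool_def Int_def)
  also have "Pow ?G \<inter> bases (whirl n) = bases (whirl n)" using whirl_basis_subset by auto
  finally show ?thesis by simp
qed

text \<open>The full rim is represented twice, clockwise and anticlockwise; this saves the \<open>1\<close>.\<close>

lemma card_bases_whirl_le:
  assumes "n \<ge> 2"
  shows "card (bases (whirl n)) \<le> 3 ^ n - 1"
proof -
  \<comment> \<open>\<open>prv\<close> is the cyclic predecessor, and \<open>N i\<close> consists of
    the edges at the rim vertex \<open>i\<close>: its spoke, the rim edge leaving it and the rim
    edge entering it.\<close>
  define prv where "prv i = (if i = 1 then n else i - 1)" for i
  define N where "N i = {Spoke i, Rim i, Rim (prv i)}" for i
  \<comment> \<open>The two representations of the full rim: by the edge leaving each vertex and by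
    the edge entering it.\<close>
  define cw ccw where "cw = restrict Rim {1..n}" and "ccw = restrict (\<lambda>i. Rim (prv i)) {1..n}"
  let ?P = "PiE {1..n} N"
  have incident: "e \<in> N i" if "i \<in> {1..n}" "e \<in> ground (whirl n)" "i \<in> wheel_ends n e" for i e
  proof (cases e)
    case (Rim j)
    then have j: "j \<in> {1..n}" "i = j \<or> i = Suc (j mod n)" using that by (auto simp: ground_whirl)
    then have "i = j \<or> j = prv i" unfolding prv_def by (cases "j = n") auto
    then show ?thesis using Rim unfolding N_def by auto
  next
    case (Spoke j)
    then show ?thesis using that unfolding N_def by (auto simp: ground_whirl)
  qed
  have "prv ` {1..n} = {1..n}"
  proof
    show "{1..n} \<subseteq> prv ` {1..n}"
    proof
      fix j assume "j \<in> {1..n}"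
      then show "j \<in> prv ` {1..n}"
        by (cases "j = n") (auto simp: prv_def image_iff intro: bexI[of _ 1] bexI[of _ "Suc j"])
    qed
  qed (use assms in \<open>auto simp: prv_def\<close>)
  then have ccw: "ccw ` {1..n} = cw ` {1..n}"
    unfolding ccw_def cw_def by (simp add: image_image[of Rim prv, symmetric])
  \<comment> \<open>The predecessor of 1 is \<open>n\<close>, which differs from 1 because
    \<open>n \<ge> 2\<close>.\<close>
  have "cw 1 \<noteq> ccw 1" using assms unfolding cw_def ccw_def prv_def by auto
  then have "cw \<noteq> ccw" by auto
  then have neq: "cw \<in> ?P - {ccw}" "ccw \<in> ?P" by (auto simp: cw_def ccw_def N_def)
  have "bases (whirl n) \<subseteq> (\<lambda>f. f ` {1..n}) ` (?P - {ccw})"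
  proof
    fix B assume "B \<in> bases (whirl n)"
    then obtain f where f: "f ` {1..n} = B"
      "\<And>i. i \<in> {1..n} \<Longrightarrow> f i \<in> ground (whirl n) \<and> i \<in> wheel_ends n (f i)"
      by (elim whirl_basis_transversal) blast
    define h where "h = restrict f {1..n}"
    have h: "h \<in> ?P" "h ` {1..n} = B" using f incident unfolding h_def by auto
    \<comment> \<open>A basis represented by the discarded \<open>ccw\<close> is the full rim, which
      \<open>cw\<close> also represents.\<close>
    show "B \<in> (\<lambda>f. f ` {1..n}) ` (?P - {ccw})"
    proof (cases "h = ccw")
      case True
      then show ?thesis using h ccw neq by blast
    qed (use h in blast)
  qed
  then have "card (bases (whirl n)) \<le> card (?P - {ccw})"
    by (rule surj_card_le[rotated]) (auto intro!: finite_PiE simp: N_def)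
  also have "\<dots> = card ?P - 1" using neq by (simp add: card_Diff_singleton)
  also have "card ?P \<le> (\<Prod>i\<in>{1..n}. 3)"
    unfolding card_PiE[OF finite_atLeastAtMost]
    by (rule prod_mono) (simp add: N_def card_insert_if)
  finally show ?thesis by (simp add: diff_le_mono)
qed

section \<open>Arcs of the rim and the rank they determine\<close>

text \<open>The first member of \<open>C\<close> met when going round the rim upwards from
  \<open>i\<close>, with \<open>i\<close> included; the second branch wraps past \<open>n\<close>.
  As \<open>Rim c\<close> leaves \<open>c\<close>, deleting the rim edges in \<open>C\<close> stops
  this walk exactly there.\<close>

definition next_in :: "nat set \<Rightarrow> nat \<Rightarrow> nat" where
  "next_in C i = (if \<exists>c\<in>C. i \<le> c then Min {c \<in> C. i \<le> c} else Min C)"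

context
  fixes n :: nat and C :: "nat set"
  assumes C: "C \<subseteq> {1..n}" and C_nonempty: "C \<noteq> {}"
begin

lemma finite_C: "finite C"
  using C finite_subset by blast

lemma next_in_mem: "next_in C i \<in> C"
proof (cases "\<exists>c\<in>C. i \<le> c")
  case True
  then have "Min {c \<in> C. i \<le> c} \<in> {c \<in> C. i \<le> c}" by (intro Min_in) (use finite_C in auto)
  then show ?thesis using True by (simp add: next_in_def)
next
  case False
  then show ?thesis using finite_C C_nonempty by (simp add: next_in_def)
qed

lemma next_in_fixed: "c \<in> C \<Longrightarrow> next_in C c = c"
  using finite_C by (auto simp: next_in_def intro!: Min_eqI)

lemma next_in_image: "next_in C ` {1..n} = C"
proof
  show "C \<subseteq> next_in C ` {1..n}"
  proof
    fix c assume "c \<in> C"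
    then show "c \<in> next_in C ` {1..n}" using C next_in_fixed[of c] by (intro image_eqI[of _ _ c]) auto
  qed
qed (use next_in_mem in auto)

text \<open>A retained rim edge stays inside one arc. At \<open>i = n\<close> both sides are the
  least member of \<open>C\<close>: on the left every member qualifies, on the right none
  does.\<close>

lemma next_in_succ:
  assumes i: "i \<in> {1..n} - C"
  shows "next_in C (Suc (i mod n)) = next_in C i"
proof (cases "i = n")
  case True
  have "{c \<in> C. Suc 0 \<le> c} = C" using C by auto
  moreover have "\<not> (\<exists>c\<in>C. i \<le> c)" using C i True by force
  ultimately show ?thesis using True C_nonempty by (auto simp: next_in_def)
next
  case False
  have iff: "i \<le> c \<longleftrightarrow> Suc i \<le> c" if "c \<in> C" for c
    using that i by (metis DiffD2 Suc_leD Suc_leI le_neq_implies_less)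
  then have "{c \<in> C. i \<le> c} = {c \<in> C. Suc i \<le> c}" by blast
  then have "next_in C (Suc i) = next_in C i" unfolding next_in_def using iff by simp
  then show ?thesis using False i by simp
qed

lemma next_in_reachable:
  assumes "i \<in> {1..n}"
  shows "(i, next_in C i) \<in> {(j, Suc (j mod n)) | j. j \<in> {1..n} - C}\<^sup>*" (is "_ \<in> ?P\<^sup>*")
proof -
  have succ: "(i, next_in C i) \<in> ?P\<^sup>*"
    if "i \<in> {1..n} - C" "(Suc (i mod n), next_in C (Suc (i mod n))) \<in> ?P\<^sup>*" for i
    using that next_in_succ[OF that(1)] by (auto intro: converse_rtrancl_into_rtrancl)
  \<comment> \<open>The downward induction from \<open>n\<close> has a base case that may wrap round
    to 1. Hence the vertices below a member of \<open>C\<close> are settled first.\<close>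
  have up: "(i, next_in C i) \<in> ?P\<^sup>*" if "c \<in> C" "i \<le> c" "1 \<le> i" for i c
    using that(2,3)
  proof (induction i rule: inc_induct)
    case base
    then show ?case using next_in_fixed[OF that(1)] by simp
  next
    case (step i)
    have "i < n" using step that(1) C by force
    show ?case
    proof (cases "i \<in> C")
      case True
      then show ?thesis using next_in_fixed by simp
    next
      case False
      then show ?thesis using \<open>i < n\<close> step succ[of i] by simp
    qed
  qed
  obtain c where c: "c \<in> C" using C_nonempty by blast
  have n: "(n, next_in C n) \<in> ?P\<^sup>*"
  proof (cases "n \<in> C")
    case True
    then show ?thesis using next_in_fixed by simp
  next
    case False
    have "1 \<le> c" "1 \<le> n" using c C by auto
    then show ?thesis using False up[OF c, of 1] succ[of n] by simp
  qed
  show ?thesis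
  proof (rule inc_induct[of i n "\<lambda>i. 1 \<le> i \<longrightarrow> (i, next_in C i) \<in> ?P\<^sup>*", THEN mp])
    show "1 \<le> n \<longrightarrow> (n, next_in C n) \<in> ?P\<^sup>*" using n by simp
    fix j assume j: "i \<le> j" "j < n" "1 \<le> Suc j \<longrightarrow> (Suc j, next_in C (Suc j)) \<in> ?P\<^sup>*"
    show "1 \<le> j \<longrightarrow> (j, next_in C j) \<in> ?P\<^sup>*"
    proof (cases "j \<in> C")
      case True
      then show ?thesis using next_in_fixed by simp
    next
      case False
      then show ?thesis using j succ[of j] by simp
    qed
  qed (use assms in auto)
qed

text \<open>Each vertex reaches the end of its arc, from there the chosen vertex \<open>s c\<close>
  of the arc, and then the hub. So these \<open>n\<close> edges connect all \<open>n + 1\<close>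
  vertices, which leaves no room for a cycle.\<close>

lemma whirl_basis_spoke_per_arc:
  assumes s: "\<And>c. c \<in> C \<Longrightarrow> s c \<in> {1..n} \<and> next_in C (s c) = c"
  shows "Rim ` ({1..n} - C) \<union> Spoke ` s ` C \<in> bases (whirl n)"
proof -
  let ?B = "Rim ` ({1..n} - C) \<union> Spoke ` s ` C"
  have sub: "?B \<subseteq> edges (wheel n)" using s by auto
  have "inj_on s C" by (rule inj_on_inverseI[of _ "next_in C"]) (use s in auto)
  then have "card (s ` C) = card C" by (rule card_image)
  moreover have "card C \<le> n" using card_mono[OF _ C] by simp
  ultimately have card: "card ?B = n"
    using C finite_C by (simp add: card_rim_Un_spoke card_Diff_subset)
  have to_next: "(i, next_in C i) \<in> (adj_rel (wheel n) ?B)\<^sup>*" if "i \<in> {1..n}" for i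
  proof -
    have "{(j, Suc (j mod n)) | j. j \<in> {1..n} - C} \<subseteq> adj_rel (wheel n) ?B"
    proof clarify
      fix j assume "j \<in> {1..n}" "j \<notin> C"
      then have "Rim j \<in> ?B" "ends (wheel n) (Rim j) = {j, Suc (j mod n)}" by auto
      then show "(j, Suc (j mod n)) \<in> adj_rel (wheel n) ?B" unfolding adj_rel_def by blast
    qed
    then show ?thesis using next_in_reachable[OF that] rtrancl_mono by blast
  qed
  have "connects (wheel n) ?B"
  proof (rule connects_root)
    fix i assume "i \<in> verts (wheel n)"
    show "(i, 0) \<in> (adj_rel (wheel n) ?B)\<^sup>*"
    proof (cases "i = 0")
      case False
      then have i: "i \<in> {1..n}" using \<open>i \<in> verts (wheel n)\<close> by auto
      define c where "c = next_in C i"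
      have c: "c \<in> C" unfolding c_def by (rule next_in_mem)
      have "(c, s c) \<in> (adj_rel (wheel n) ?B)\<^sup>*"
        using to_next[of "s c"] s[OF c] rtrancl_adj_rel_commute by metis
      moreover have "(s c, 0) \<in> adj_rel (wheel n) ?B"
      proof -
        have "Spoke (s c) \<in> ?B" "ends (wheel n) (Spoke (s c)) = {s c, 0}" using c by auto
        then show ?thesis unfolding adj_rel_def by blast
      qed
      moreover have "(i, c) \<in> (adj_rel (wheel n) ?B)\<^sup>*" using to_next[OF i] unfolding c_def .
      ultimately show ?thesis by (meson rtrancl_into_rtrancl rtrancl_trans)
    qed simp
  qed simp
  moreover from this have "acyclic_edges (wheel n) ?B"
  proof (rule connected_few_edges_acyclic)
    show "ends (wheel n) e \<subseteq> verts (wheel n)" if "e \<in> ?B" for e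
      using wheel_ends_subset[of e n] that sub unfolding wheel_simps by blast
    show "card ?B < card (verts (wheel n))" unfolding card by simp
  qed (use finite_C in simp)
  ultimately show ?thesis using sub by (simp add: bases_whirl spanning_tree_def del: wheel_simps)
qed

text \<open>
  Deleting the rim edges in \<open>C\<close> cuts the rim into arcs indexed by their last vertex, which is the
  value of \<open>next_in C\<close> on the arc. An arc on \<open>k\<close> vertices has rank \<open>k\<close> if it meets \<open>S\<close> and
  \<open>k - 1\<close> otherwise.
\<close>

lemma rank_whirl_arcs:
  assumes S: "S \<subseteq> {1..n}"
  shows "rank (whirl n) (Rim ` ({1..n} - C) \<union> Spoke ` S) = card ({1..n} - C) + card (next_in C ` S)"
    (is "rank _ ?A = card ?R + card ?D")
proof (rule antisym)
  have fin: "finite S" "finite ?D" "?D \<subseteq> C" using S finite_subset next_in_mem by auto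
  \<comment> \<open>\<open>?D\<close> lists the last vertices of the arcs that meet
    \<open>S\<close>. Read as vertices, \<open>?arcs\<close> are the other vertices of these arcs;
    read as rim edges, \<open>?bare\<close> are the retained edges of the arcs that miss
    \<open>S\<close>.\<close>
  let ?arcs = "{j \<in> ?R. next_in C j \<in> ?D}"
  let ?bare = "{j \<in> ?R. next_in C j \<notin> ?D}"
  obtain B where B: "B \<in> bases (whirl n)" "rank (whirl n) ?A = card (?A \<inter> B)"
    by (rule rank_whirl_attained)
  obtain f where f: "inj_on f {1..n}" "f ` {1..n} = B"
    "\<And>i. i \<in> {1..n} \<Longrightarrow> f i \<in> ground (whirl n) \<and> i \<in> wheel_ends n (f i)"
    by (rule whirl_basis_transversal[OF B(1)]) blast
  \<comment> \<open>Upper bound: an element of the intersection is represented by a vertex. If that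
    vertex lies on an arc missing \<open>S\<close>, the element is not a spoke, hence it is a rim
    edge of the same arc.\<close>
  have "?A \<inter> B \<subseteq> f ` (?arcs \<union> ?D) \<union> Rim ` ?bare"
  proof
    fix e assume e: "e \<in> ?A \<inter> B"
    then obtain i where i: "i \<in> {1..n}" "e = f i" using f(2) by blast
    show "e \<in> f ` (?arcs \<union> ?D) \<union> Rim ` ?bare"
    proof (cases "next_in C i \<in> ?D")
      case True
      then have "i \<in> ?arcs \<union> ?D" using i next_in_fixed[of i] by auto
      then show ?thesis using i by blast
    next
      case False
      have ie: "i \<in> wheel_ends n e" using f(3) i by blast
      have "i \<noteq> 0" using i by simp
      then have "e \<noteq> Spoke k" if "k \<in> S" for k using ie False that by auto
      then obtain j where j: "e = Rim j" "j \<in> ?R" using e by blast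
      then have "i = j \<or> i = Suc (j mod n)" using ie by auto
      then have "next_in C i = next_in C j" using next_in_succ[OF j(2)] by auto
      then show ?thesis using j False by auto
    qed
  qed
  then have "card (?A \<inter> B) \<le> card (f ` (?arcs \<union> ?D) \<union> Rim ` ?bare)"
    by (rule card_mono[rotated]) (use fin in auto)
  also have "\<dots> \<le> card (f ` (?arcs \<union> ?D)) + card (Rim ` ?bare)" by (rule card_Un_le)
  also have "\<dots> \<le> card (?arcs \<union> ?D) + card ?bare"
    by (intro add_mono card_image_le) (use fin in auto)
  also have "\<dots> \<le> card ?arcs + card ?D + card ?bare" by (simp add: card_Un_le)
  also have "\<dots> = card ?R + card ?D"
  proof -
    have "card ?R = card (?arcs \<union> ?bare)" by (rule arg_cong[of _ _ card]) blast
    also have "\<dots> = card ?arcs + card ?bare" by (rule card_Un_disjoint) auto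
    finally show ?thesis by simp
  qed
  finally show "rank (whirl n) ?A \<le> card ?R + card ?D" using B by simp

  \<comment> \<open>Lower bound: a basis with one spoke per arc, taken from \<open>S\<close> where
    the arc meets \<open>S\<close>, contains all retained rim edges and one available spoke for each
    member of \<open>?D\<close>.\<close>
  have "\<exists>i\<in>{1..n}. next_in C i = c \<and> (c \<in> ?D \<longrightarrow> i \<in> S)" if "c \<in> C" for c
  proof (cases "c \<in> ?D")
    case True
    then show ?thesis using S by auto
  next
    case False
    then show ?thesis using that C next_in_fixed by blast
  qed
  then obtain s where s: "\<And>c. c \<in> C \<Longrightarrow> s c \<in> {1..n} \<and> next_in C (s c) = c \<and> (c \<in> ?D \<longrightarrow> s c \<in> S)"
    by metis
  let ?B = "Rim ` ?R \<union> Spoke ` s ` C"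
  have "?B \<in> bases (whirl n)" by (rule whirl_basis_spoke_per_arc) (use s in blast)
  then have "card (?A \<inter> ?B) \<le> rank (whirl n) ?A" by (rule rank_whirl_ge)
  moreover have "card (Rim ` ?R \<union> Spoke ` s ` ?D) \<le> card (?A \<inter> ?B)"
    by (rule card_mono) (use fin s in auto)
  moreover have "inj_on s ?D" by (rule inj_on_inverseI[of _ "next_in C"]) (use s fin in blast)
  then have "card (Rim ` ?R \<union> Spoke ` s ` ?D) = card ?R + card ?D"
    using fin by (simp add: card_rim_Un_spoke card_image)
  ultimately show "card ?R + card ?D \<le> rank (whirl n) ?A" by linarith
qed

end

section \<open>The value at (2,0) and the comparison\<close>

lemma tutte_whirl_2_0:
  assumes "n \<ge> 1"
  shows "tutte (whirl n) (2 :: 'r::comm_ring_1) 0 = 3 ^ n - 1"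
proof -
  let ?N = "{1..n}"
  let ?A = "\<lambda>C S. Rim ` (?N - C) \<union> Spoke ` S"
  let ?w = "\<lambda>A. (-1 :: 'r) ^ (card A - rank (whirl n) A)"
  \<comment> \<open>\<open>C\<close> records the absent rim edges and \<open>S\<close> the present
    spokes, hence the complement in the inverse map.\<close>
  have bij: "bij_betw (\<lambda>(C, S). ?A C S) (Pow ?N \<times> Pow ?N) (Pow (ground (whirl n)))"
  proof (rule bij_betwI[where g = "\<lambda>A. (?N - Rim -` A, Spoke -` A)"])
    show "(\<lambda>A. (?N - Rim -` A, Spoke -` A)) \<in> Pow (ground (whirl n)) \<rightarrow> Pow ?N \<times> Pow ?N"
      by (auto simp: ground_whirl)
    fix A assume "A \<in> Pow (ground (whirl n))"
    then show "(\<lambda>(C, S). ?A C S) (?N - Rim -` A, Spoke -` A) = A"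
      by (auto simp: ground_whirl)
  qed (auto simp: ground_whirl)
  have inner: "(\<Sum>S\<in>Pow ?N. ?w (?A C S)) = (if C = {} then 0 else 2 ^ card C)" if "C \<subseteq> ?N" for C
  proof (cases "C = {}")
    case True
    \<comment> \<open>The full rim already has rank \<open>n\<close>, so every spoke added to it
      raises the nullity by one.\<close>
    have "?w (?A C S) = (-1) ^ card S" if "S \<subseteq> ?N" for S
    proof -
      have "finite S" using that finite_subset by blast
      then show ?thesis using rank_whirl_rim[of n "?A C S"] True by (simp add: card_rim_Un_spoke)
    qed
    then have "(\<Sum>S\<in>Pow ?N. ?w (?A C S)) = (\<Sum>S\<in>Pow ?N. (-1) ^ card S)" by simp
    also have "\<dots> = 0"
      using sum_Pow_binomial[of ?N "-1 :: 'r" 1] assms by (simp add: power_0_left)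
    finally show ?thesis using True by simp
  next
    case False
    have "?w (?A C S) = (-1) ^ (card S - card (next_in C ` S))" if S: "S \<subseteq> ?N" for S
    proof -
      have "finite S" using S finite_subset by blast
      then show ?thesis using rank_whirl_arcs[OF \<open>C \<subseteq> ?N\<close> False S] by (simp add: card_rim_Un_spoke)
    qed
    then have "(\<Sum>S\<in>Pow ?N. ?w (?A C S)) = (\<Sum>S\<in>Pow ?N. (-1) ^ (card S - card (next_in C ` S)))"
      by simp
    also have "\<dots> = 2 ^ card C"
      using next_in_image[OF that False] finite_subset[OF that] by (intro sum_Pow_signed_image_excess) auto
    finally show ?thesis using False by simp
  qed
  have "tutte (whirl n) (2 :: 'r) 0 = (\<Sum>A\<in>Pow (ground (whirl n)). ?w A)"
    by (simp add: tutte_def)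
  also have "\<dots> = (\<Sum>(C, S)\<in>Pow ?N \<times> Pow ?N. ?w (?A C S))"
    using sum.reindex_bij_betw[OF bij, of ?w] by (simp add: case_prod_unfold)
  also have "\<dots> = (\<Sum>C\<in>Pow ?N. \<Sum>S\<in>Pow ?N. ?w (?A C S))"
    by (simp add: sum.cartesian_product)
  also have "\<dots> = (\<Sum>C\<in>Pow ?N. if C = {} then 0 else 2 ^ card C)"
    by (rule sum.cong) (use inner in auto)
  \<comment> \<open>The empty \<open>C\<close> fits the pattern after subtracting 1, since 2^0 - 1 =
    0.\<close>
  also have "\<dots> = (\<Sum>C\<in>Pow ?N. 2 ^ card C - (if C = {} then 1 else 0))"
    by (rule sum.cong) auto
  also have "\<dots> = (\<Sum>C\<in>Pow ?N. 2 ^ card C) - 1"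
    by (simp add: sum_subtractf)
  also have "(\<Sum>C\<in>Pow ?N. 2 ^ card C) = (3 :: 'r) ^ n"
    using sum_Pow_binomial[of ?N "2 :: 'r" 1] by simp
  finally show ?thesis .
qed

theorem theorem5p2:
  fixes n :: nat
  assumes "n \<ge> 2"
  shows "tutte (whirl n) (2::real) 0 \<ge> tutte (whirl n) 1 1
    \<and> max (tutte (whirl n) (2::real) 0) (tutte (whirl n) 0 2) \<ge> tutte (whirl n) 1 1"
proof -
  have "real (card (bases (whirl n))) \<le> real (3 ^ n - 1)"
    using card_bases_whirl_le[OF assms] of_nat_mono by blast
  then have "tutte (whirl n) 1 1 \<le> tutte (whirl n) (2::real) 0"
    using tutte_1_1_le_card_bases[of n] tutte_whirl_2_0[of n, where 'r = real] assms by (simp add: of_nat_diff)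
  then show ?thesis by simp
qed

end
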